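(* Let $\beta,\gamma\in[0,2)$ with $\beta+\gamma<2$. Let $$\mathcal{S}^{\beta,\gamma}_{n}=\Big\{1-\gamma-\frac{(2-\beta-\gamma)(2j-1)}{2n}\Big\}_{j=1,\dots,n}\quad(n\ge1),$$ $$\mathcal{E}^{\beta,\gamma}_{n}=\Big\{1-\gamma-\frac{(2-\beta-\gamma)j}{n-1}\Big\}_{j=0,\dots,n-1}\quad(n\ge2).$$ Then $$\mathcal{T}^{\beta,\gamma}_{n}=M_1\big(\mathcal{S}^{\beta,\gamma}_{n}\big)\ \ (n\ge1),\qquad \mathcal{U}^{\beta,\gamma}_{n}=M_1\big(\mathcal{E}^{\beta,\gamma}_{n}\big)\ \ (n\ge2).$$
   Context: The Kosloff Tal-Ezer map with parameter $\alpha\in(0,1]$ is $M_\alpha(x)=\frac{\sin(\alpha\pi x/2)}{\sin(\alpha\pi/2)}$, $x\in[-1,1]$; in particular $M_1(x)=\sin(\pi x/2)$. For a set $A\subset[-1,1]$, $M_1(A)=\{M_1(a): a\in A\}$. For $\beta,\gamma\in[0,2)$ with $\beta+\gamma<2$, the $(\beta,\gamma)$-Chebyshev points and $(\beta,\gamma)$-Chebyshev-Lobatto points are $$\mathcal{T}^{\beta,\gamma}_n=\Big\{\cos\Big(\frac{(2-\beta-\gamma)(2j-1)\pi}{4n}+\frac{\gamma\pi}{2}\Big)\Big\}_{j=1,\dots,n}\ (n\ge1),\qquad \mathcal{U}^{\beta,\gamma}_{n}=\Big\{\cos\Big(\frac{(2-\beta-\gamma)j\pi}{2(n-1)}+\frac{\gamma\pi}{2}\Big)\Big\}_{j=0,\dots,n-1}\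 (n\ge2).$$ *)

theory Defs
  imports Complex_Main
begin

text \<open>
  The Kosloff Tal-Ezer map with parameter \<open>\<alpha>\<close>, meant for \<open>0 < \<alpha> \<le> 1\<close> and arguments in
  \<open>[-1, 1]\<close>; outside this range the same formula is used. The lemmas
  \<open>S_nodes_subset\<close> and \<open>E_nodes_subset\<close> below show that it is only ever applied
  to points of \<open>[-1, 1]\<close>.
\<close>

definition kte_map :: "real \<Rightarrow> real \<Rightarrow> real" where
  "kte_map \<alpha> x = sin (\<alpha> * pi * x / 2) / sin (\<alpha> * pi / 2)"

definition cheb_points :: "real \<Rightarrow> real \<Rightarrow> nat \<Rightarrow> real set" where
  "cheb_points \<beta> \<gamma> n =
     (\<lambda>j. cos ((2 - \<beta> - \<gamma>) * (2 * real j - 1) * pi / (4 * real n) + \<gamma> * pi / 2)) ` {1..n}"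

definition cheb_lobatto_points :: "real \<Rightarrow> real \<Rightarrow> nat \<Rightarrow> real set" where
  "cheb_lobatto_points \<beta> \<gamma> n =
     (\<lambda>j. cos ((2 - \<beta> - \<gamma>) * real j * pi / (2 * (real n - 1)) + \<gamma> * pi / 2)) ` {0..n - 1}"

definition S_nodes :: "real \<Rightarrow> real \<Rightarrow> nat \<Rightarrow> real set" where
  "S_nodes \<beta> \<gamma> n =
     (\<lambda>j. 1 - \<gamma> - (2 - \<beta> - \<gamma>) * (2 * real j - 1) / (2 * real n)) ` {1..n}"

definition E_nodes :: "real \<Rightarrow> real \<Rightarrow> nat \<Rightarrow> real set" where
  "E_nodes \<beta> \<gamma> n =
     (\<lambda>j. 1 - \<gamma> - (2 - \<beta> - \<gamma>) * real j / (real n - 1)) ` {0..n - 1}"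

lemma node_in_interval:
  fixes \<beta> \<gamma> t :: real
  assumes "0 \<le> \<beta>" "0 \<le> \<gamma>" "\<beta> + \<gamma> < 2" "0 \<le> t" "t \<le> 1"
  shows "1 - \<gamma> - (2 - \<beta> - \<gamma>) * t \<in> {-1..1}"
proof -
  have "0 \<le> (2 - \<beta> - \<gamma>) * t" using assms by simp
  moreover have "(2 - \<beta> - \<gamma>) * t \<le> 2 - \<beta> - \<gamma>"
    using mult_left_mono[of t 1 "2 - \<beta> - \<gamma>"] assms by simp
  ultimately show ?thesis using assms unfolding atLeastAtMost_iff by linarith
qed

lemma S_nodes_subset:
  assumes "0 \<le> \<beta>" "0 \<le> \<gamma>" "\<beta> + \<gamma> < 2"
  shows "S_nodes \<beta> \<gamma> n \<subseteq> {-1..1}"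
proof
  fix x assume "x \<in> S_nodes \<beta> \<gamma> n"
  then obtain j where j: "1 \<le> j" "j \<le> n"
    and x: "x = 1 - \<gamma> - (2 - \<beta> - \<gamma>) * ((2 * real j - 1) / (2 * real n))"
    by (auto simp: S_nodes_def)
  have "0 \<le> (2 * real j - 1) / (2 * real n)" "(2 * real j - 1) / (2 * real n) \<le> 1"
    using j by (auto simp: field_simps)
  then show "x \<in> {-1..1}" unfolding x by (rule node_in_interval[OF assms])
qed

lemma E_nodes_subset:
  assumes "0 \<le> \<beta>" "0 \<le> \<gamma>" "\<beta> + \<gamma> < 2" "2 \<le> n"
  shows "E_nodes \<beta> \<gamma> n \<subseteq> {-1..1}"
proof
  fix x assume "x \<in> E_nodes \<beta> \<gamma> n"
  then obtain j where j: "j \<le> n - 1"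
    and x: "x = 1 - \<gamma> - (2 - \<beta> - \<gamma>) * (real j / (real n - 1))"
    by (auto simp: E_nodes_def)
  have "real j \<le> real n - 1" using j assms(4) by linarith
  then have "0 \<le> real j / (real n - 1)" "real j / (real n - 1) \<le> 1"
    using assms(4) by (auto simp: divide_le_eq)
  then show "x \<in> {-1..1}" unfolding x by (rule node_in_interval[OF assms(1-3)])
qed

end

theory Submission
  imports Defs
begin

text \<open>For \<alpha> = 1 the denominator is sin(pi/2) = 1, and the complement rule sin(pi/2 - u)
  = cos u sends a node 1 - \<gamma> - t to the cosine of (t + \<gamma>) pi/2. Every node has this
  form, with t its offset from 1 - \<gamma>.\<close>

lemma kte_map_one_diff: "kte_map 1 (1 - \<gamma> - t) = cos (t * pi / 2 + \<gamma> * pi / 2)"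
proof -
  have "pi * (1 - \<gamma> - t) / 2 = pi / 2 - (t * pi / 2 + \<gamma> * pi / 2)"
    by (simp add: field_simps)
  then have "sin (pi * (1 - \<gamma> - t) / 2) = cos (t * pi / 2 + \<gamma> * pi / 2)"
    \<comment> \<open>\<open>cos_sin_eq\<close> embeds \<open>pi\<close> through
      \<open>of_real\<close>, which is the identity on the reals.\<close>
    by (simp only: cos_sin_eq of_real_eq_id id_apply)
  then show ?thesis
    by (simp add: kte_map_def)
qed

theorem proposition5:
  fixes \<beta> \<gamma> :: real
  assumes "\<beta> \<in> {0..<2}" and "\<gamma> \<in> {0..<2}" and "\<beta> + \<gamma> < 2"
  shows "(\<forall>n\<ge>1. cheb_points \<beta> \<gamma> n = kte_map 1 ` S_nodes \<beta> \<gamma> n)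
       \<and> (\<forall>n\<ge>2. cheb_lobatto_points \<beta> \<gamma> n = kte_map 1 ` E_nodes \<beta> \<gamma> n)"
proof -
  have "cheb_points \<beta> \<gamma> n = kte_map 1 ` S_nodes \<beta> \<gamma> n" for n
    \<comment> \<open>Both sides are images of one index set and agree for each \<open>j\<close>:
      the factor \<open>pi / 2\<close> turns the denominator \<open>2 * n\<close> into
      \<open>4 * n\<close>.\<close>
    unfolding cheb_points_def S_nodes_def image_image kte_map_one_diff
    by (simp add: mult.commute)
  moreover have "cheb_lobatto_points \<beta> \<gamma> n = kte_map 1 ` E_nodes \<beta> \<gamma> n" for n
    \<comment> \<open>Here \<open>n - 1\<close> becomes \<open>2 * (n - 1)\<close> in the same
      way.\<close>
    unfolding cheb_lobatto_points_def E_nodes_def image_image kte_map_one_diff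
    by (simp add: mult.commute)
  ultimately show ?thesis
    by blast
qed

end
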